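(* Let $A,B,\Omega\in\mathbb{R}^{n\times n}$ and $b\in\mathbb{R}^n$ be such that the generalized absolute value equation $Ax-B|x|=b$ has a unique solution $x^{\ast}\in\mathbb{R}^n$. Let $A+B$ and $A+B+\Omega$ be invertible. If $$\|(A+B)^{-1}\|_{2}<\bigl(2\|\Omega\|_{2}+2\|B\|_{2}\bigr)^{-1},$$ then the maximum-based iteration method $$x^{k+1}=(A+B+\Omega)^{-1}\bigl(\Omega x^{k}+2B\max\{0,x^{k}\}+b\bigr),\quad k=0,1,2,\ldots,$$ is convergent, i.e., for every initial vector $x^{0}\in\mathbb{R}^n$ the sequence $\{x^k\}$ converges to $x^{\ast}$.
   Context: For $x\in\mathbb{R}^n$, $|x|$ denotes the entrywise absolute value and $\max\{0,x\}$ the entrywise maximum of $x$ and the zero vector. $\|\cdot\|_2$ denotes the matrix 2-norm (spectral norm). *)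

theory Defs
  imports "HOL-Analysis.Analysis"
begin

(* The library's norm on real^'n^'n is the Frobenius norm. The spectral norm is the operator
   norm induced by the Euclidean norm, which is the library's norm on real^'n. *)
definition spectral_norm :: "real^'n^'n \<Rightarrow> real" where
  "spectral_norm A = onorm (\<lambda>x. A *v x)"

definition vec_max :: "real^'n \<Rightarrow> real^'n \<Rightarrow> real^'n" where
  "vec_max x y = (\<chi> i. max (x $ i) (y $ i))"

(* The absolute value on real^'n is the library's, which is entrywise (abs_vec_def). *)
definition gave_solution :: "real^'n^'n \<Rightarrow> real^'n^'n \<Rightarrow> real^'n \<Rightarrow> real^'n \<Rightarrow> bool" where
  "gave_solution A B b x \<longleftrightarrow> A *v x - B *v \<bar>x\<bar> = b"

primrec max_iteration ::
  "real^'n^'n \<Rightarrow> real^'n^'n \<Rightarrow> real^'n^'n \<Rightarrow> real^'n \<Rightarrow> real^'n \<Rightarrow> nat \<Rightarrow> real^'n"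
where
  "max_iteration A B \<Omega> b x0 0 = x0"
| "max_iteration A B \<Omega> b x0 (Suc k) =
     matrix_inv (A + B + \<Omega>) *v
       (\<Omega> *v max_iteration A B \<Omega> b x0 k
        + 2 *\<^sub>R (B *v vec_max 0 (max_iteration A B \<Omega> b x0 k)) + b)"

end

theory Submission
  imports Defs
begin

text \<open>Since \<open>x + \<bar>x\<bar> = 2 max{0,x}\<close>, the solution is a fixed point of the iteration. Write \<open>e\<close> and \<open>e'\<close>
for consecutive errors and \<open>m\<close>, \<open>w\<close>, \<open>\<beta>\<close> for the spectral norms of \<open>(A+B)\<inverse>\<close>, \<open>\<Omega>\<close>, \<open>B\<close>. Moving
\<open>\<Omega> e'\<close> to the right-hand side gives \<open>(A+B) e' = \<Omega> (e - e') + 2 B d\<close> with \<open>\<parallel>d\<parallel> \<le> \<parallel>e\<parallel>\<close>, so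
\<open>(1 - m w) \<parallel>e'\<parallel> \<le> m (w + 2 \<beta>) \<parallel>e\<parallel>\<close>, and the hypothesis \<open>2 m (w + \<beta>) < 1\<close> says exactly that
\<open>m (w + 2 \<beta>) < 1 - m w\<close>.\<close>

lemma spectral_norm_nonneg: "0 \<le> spectral_norm (A :: real^'n^'n)"
  unfolding spectral_norm_def by (simp add: onorm_pos_le)

lemma norm_matrix_vector_le_spectral_norm:
  "norm (A *v x) \<le> spectral_norm (A :: real^'n^'n) * norm x"
  unfolding spectral_norm_def by (intro onorm matrix_vector_mul_bounded_linear)

lemma matrix_inv_mult:
  fixes A :: "real^'n^'n"
  assumes "invertible A"
  shows "A ** matrix_inv A = mat 1" "matrix_inv A ** A = mat 1"
  using someI_ex[OF assms[unfolded invertible_def]] by (simp_all add: matrix_inv_def)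

text \<open>In each coordinate, \<open>max c\<close> with \<open>c\<close> fixed is
  1-Lipschitz.\<close>

lemma norm_vec_max_diff_le: "norm (vec_max z x - vec_max z y) \<le> norm (x - y)"
  by (rule norm_le_componentwise_cart) (auto simp: vec_max_def max_def)

text \<open>Adding \<open>\<Omega> *v x\<close> to both sides of this form gives the fixed-point
  equation of the iteration.\<close>

lemma gave_solution_iff_vec_max:
  "gave_solution A B b x \<longleftrightarrow> (A + B) *v x = 2 *\<^sub>R (B *v vec_max 0 x) + b"
proof -
  have "2 *\<^sub>R vec_max 0 x = x + \<bar>x\<bar>"
    by (auto simp: vec_eq_iff vec_max_def abs_vec_def max_def)
  then have "2 *\<^sub>R (B *v vec_max 0 x) = B *v x + B *v \<bar>x\<bar>"
    by (metis matrix_vector_mult_scaleR matrix_vector_right_distrib)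
  then show ?thesis
    by (auto simp: gave_solution_def algebra_simps)
qed

text \<open>The factor \<open>1 - m * w\<close> stays on the left: its sign is settled only by the
  norm bound of the final theorem.\<close>

lemma norm_max_iteration_error_le:
  fixes A B \<Omega> :: "real^'n^'n" and x0 xstar :: "real^'n"
  defines "m \<equiv> spectral_norm (matrix_inv (A + B))"
    and "w \<equiv> spectral_norm \<Omega>" and "\<beta> \<equiv> spectral_norm B"
  assumes sol: "gave_solution A B b xstar"
    and M: "invertible (A + B)" and N: "invertible (A + B + \<Omega>)"
  shows "(1 - m * w) * norm (max_iteration A B \<Omega> b x0 (Suc k) - xstar)
    \<le> m * (w + 2 * \<beta>) * norm (max_iteration A B \<Omega> b x0 k - xstar)"
proof -
  define x where "x = max_iteration A B \<Omega> b x0 k"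
  define y where "y = max_iteration A B \<Omega> b x0 (Suc k)"
  define d where "d = vec_max 0 x - vec_max 0 xstar"
  define r where "r = \<Omega> *v (x - y) + 2 *\<^sub>R (B *v d)"
  have "(A + B + \<Omega>) *v y = \<Omega> *v x + 2 *\<^sub>R (B *v vec_max 0 x) + b"
    by (simp add: x_def y_def matrix_vector_mul_assoc matrix_inv_mult[OF N])
  then have "(A + B) *v (y - xstar) = r"
    using sol[unfolded gave_solution_iff_vec_max]
    by (simp add: r_def d_def algebra_simps)
  then have "y - xstar = matrix_inv (A + B) *v r"
    by (metis M matrix_inv_mult(2) matrix_vector_mul_assoc matrix_vector_mul_lid)
  then have y: "norm (y - xstar) \<le> m * norm r"
    by (simp only: m_def norm_matrix_vector_le_spectral_norm)
  have "norm r \<le> norm (\<Omega> *v (x - y)) + 2 * norm (B *v d)"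
    unfolding r_def using norm_triangle_ineq[of "\<Omega> *v (x - y)" "2 *\<^sub>R (B *v d)"] by simp
  also have "\<dots> \<le> w * norm (x - y) + 2 * (\<beta> * norm d)"
    using norm_matrix_vector_le_spectral_norm[of \<Omega> "x - y"]
      norm_matrix_vector_le_spectral_norm[of B d] by (simp add: w_def \<beta>_def)
  \<comment> \<open>Splitting \<open>x - y\<close> at \<open>xstar\<close> brings back the new error
    \<open>y - xstar\<close>; after scaling by \<open>m\<close>, its term moves to the left and
    yields \<open>1 - m * w\<close>.\<close>
  also have "\<dots> \<le> w * (norm (x - xstar) + norm (y - xstar)) + 2 * (\<beta> * norm (x - xstar))"
  proof -
    have "norm (x - y) \<le> norm (x - xstar) + norm (y - xstar)"
      using norm_triangle_ineq4[of "x - xstar" "y - xstar"] by simp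
    then show ?thesis
      unfolding d_def w_def \<beta>_def
      by (intro add_mono mult_left_mono norm_vec_max_diff_le spectral_norm_nonneg) simp_all
  qed
  finally have "m * norm r \<le> m * \<dots>"
    by (rule mult_left_mono) (simp add: m_def spectral_norm_nonneg)
  with y have "(1 - m * w) * norm (y - xstar) \<le> m * (w + 2 * \<beta>) * norm (x - xstar)"
    by (simp add: algebra_simps)
  then show ?thesis
    by (simp only: x_def y_def)
qed

text \<open>Iterating the step bounds the error by a null geometric sequence.\<close>

lemma tendsto_of_norm_contraction:
  fixes x :: "nat \<Rightarrow> 'a::real_normed_vector"
  assumes "0 \<le> q" "q < 1" and step: "\<And>k. norm (x (Suc k) - l) \<le> q * norm (x k - l)"
  shows "x \<longlonglongrightarrow> l"
proof -
  have "norm (x k - l) \<le> q ^ k * norm (x 0 - l)" for k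
  proof (induction k)
    case (Suc k)
    then show ?case
      using step[of k] mult_left_mono[OF Suc \<open>0 \<le> q\<close>] by (simp add: mult.assoc)
  qed simp
  moreover have "(\<lambda>k. q ^ k * norm (x 0 - l)) \<longlonglongrightarrow> 0"
    using assms by (intro tendsto_mult_left_zero LIMSEQ_realpow_zero)
  ultimately have "(\<lambda>k. x k - l) \<longlonglongrightarrow> 0"
    by (rule Lim_null_comparison[OF always_eventually[OF allI]])
  then show ?thesis
    by (simp add: LIM_zero_iff)
qed

theorem theorem2p2:
  fixes A B \<Omega> :: "real^'n^'n" and b xstar :: "real^'n"
  assumes "\<exists>!x. gave_solution A B b x"
    and "gave_solution A B b xstar"
    and "invertible (A + B)"
    and "invertible (A + B + \<Omega>)"
    and "spectral_norm (matrix_inv (A + B)) < inverse (2 * spectral_norm \<Omega> + 2 * spectral_norm B)"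
  shows "\<forall>x0. (\<lambda>k. max_iteration A B \<Omega> b x0 k) \<longlonglongrightarrow> xstar"
proof
  fix x0
  define m where "m = spectral_norm (matrix_inv (A + B))"
  define w where "w = spectral_norm \<Omega>"
  define \<beta> where "\<beta> = spectral_norm B"
  define q where "q = m * (w + 2 * \<beta>) / (1 - m * w)"
  have nonneg: "0 \<le> m" "0 \<le> w" "0 \<le> \<beta>"
    by (simp_all add: m_def w_def \<beta>_def spectral_norm_nonneg)
  have m: "m < inverse (2 * w + 2 * \<beta>)"
    using assms(5) by (simp add: m_def w_def \<beta>_def)
  \<comment> \<open>If \<open>\<Omega> = B = 0\<close>, the bound is \<open>inverse 0 = 0\<close> and the hypothesis fails.\<close>
  then have "0 < 2 * w + 2 * \<beta>"
    using nonneg by (metis inverse_positive_iff_positive le_less_trans)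
  then have bound: "m * (2 * w + 2 * \<beta>) < 1"
    using m by (simp add: field_simps)
  \<comment> \<open>These give \<open>m * w \<le> m * (2 * w + 2 * \<beta>) < 1\<close>, so dividing
    by \<open>1 - m * w\<close> is legitimate.\<close>
  have "0 \<le> m * w" "0 \<le> m * \<beta>"
    using nonneg by simp_all
  with bound have pos: "0 < 1 - m * w" and lt: "m * (w + 2 * \<beta>) < 1 - m * w"
    by (simp_all add: algebra_simps)
  show "(\<lambda>k. max_iteration A B \<Omega> b x0 k) \<longlonglongrightarrow> xstar"
  proof (rule tendsto_of_norm_contraction)
    show "0 \<le> q" "q < 1"
      using nonneg pos lt by (simp_all add: q_def)
    show "norm (max_iteration A B \<Omega> b x0 (Suc k) - xstar)
        \<le> q * norm (max_iteration A B \<Omega> b x0 k - xstar)" for k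
      using norm_max_iteration_error_le[OF assms(2-4), of x0 k] pos
      by (simp add: q_def m_def w_def \<beta>_def pos_le_divide_eq mult.commute del: max_iteration.simps)
  qed
qed

end
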